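(* Let $\lambda=(\lambda_i)_{i\ge1}$ be a sequence of distinct points of the open unit disk $\mathbb{D}$ with an accumulation point in $\mathbb{D}$, let $w=(w_i)_{i\ge1}$ be a sequence in $\mathbb{C}$, and let $C>0$. Let $1\le q\le\infty$, $\beta\in\mathbb{R}$, and $\frac1p+\frac1q=1$. Suppose that $$\Big|\sum_{i=1}^n\alpha_iw_i\Big|\le C\left(\Big|\sum_{i=1}^n\alpha_i\Big|^p+\sum_{j\ge1}j^{\beta p}\Big|\sum_{i=1}^n\alpha_i\lambda_i^j\Big|^p\right)^{1/p}$$ for every $n\ge1$ and every sequence of complex numbers $(\alpha_i)_{i\ge1}$. Then there exists a unique function $f\in l_A^q(-\beta)$ such that $f(\lambda_i)=w_i$ for all $i\ge1$ and $\|f\|_{l_A^q(-\beta)}\le C$. Moreover, the inequality $$\Big|\sum_{i=1}^n\alpha_if(z_i)\Big|\le C\left(\Big|\sum_{i=1}^n\alpha_i\Big|^p+\sum_{j\ge1}j^{\beta p}\Big|\sum_{i=1}^n\alpha_iz_i^j\Big|^p\right)^{1/p}$$ holds for every $n\ge1$, every sequence of distinct points $(z_i)\subset\mathbb{D}$ and every sequence of complex numbers $(\alpha_i)$. (When $p=\infty$, the expression $(|a_0|^p+\sum_{j\ge1}j^{\beta p}|a_j|^p)^{1/p}$ is read as $\sup\{|a_0|,\ \sup_{j\ge1}j^\beta|a_j|\}$.)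
   Context: For $\gamma\in\mathbb{R}$ and $q\in[1,\infty]$, the Beurling–Sobolev space $l_A^q(\gamma)$ consists of all $f=\sum_{j\ge0}\hat f(j)z^j$ holomorphic on $\mathbb{D}$ with $$\|f\|_{l_A^q(\gamma)}=\Big(\sum_{j\ge0}|\hat f(j)|^q\omega_j^q\Big)^{1/q}<\infty,\qquad \omega_0=1,\ \omega_j=j^\gamma\ (j\ge1),$$ with the norm $\sup_{j\ge0}|\hat f(j)|\omega_j$ when $q=\infty$. *)

theory Defs
  imports "HOL-Complex_Analysis.Complex_Analysis" "HOL-Library.FuncSet" "HOL-Real_Asymp.Real_Asymp"
begin

definition weight :: "real \<Rightarrow> nat \<Rightarrow> real" where
  "weight \<gamma> j = (if j = 0 then 1 else real j powr \<gamma>)"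

(* Exponents range over [1, \<infinity>] as elements of ennreal.  The norm is real-valued, so it is
   meaningful only for sequences in weighted_lp; for all other sequences it is a junk value. *)

definition weighted_lp :: "ennreal \<Rightarrow> real \<Rightarrow> (nat \<Rightarrow> complex) set" where
  "weighted_lp q \<gamma> = {a.
     if q = \<infinity> then bdd_above (range (\<lambda>j. norm (a j) * weight \<gamma> j))
     else summable (\<lambda>j. norm (a j) powr enn2real q * weight \<gamma> j powr enn2real q)}"

definition weighted_lp_norm :: "ennreal \<Rightarrow> real \<Rightarrow> (nat \<Rightarrow> complex) \<Rightarrow> real" where
  "weighted_lp_norm q \<gamma> a =
     (if q = \<infinity> then (SUP j. norm (a j) * weight \<gamma> j)
      else (\<Sum>j. norm (a j) powr enn2real q * weight \<gamma> j powr enn2real q) powr (1 / enn2real q))"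

definition taylor_coeff :: "(complex \<Rightarrow> complex) \<Rightarrow> nat \<Rightarrow> complex" where
  "taylor_coeff f j = fps_nth (fps_expansion f 0) j"

(* Functions on the disk are represented by functions on the complex plane that are undefined
   outside the disk, so that equality of elements is equality on the disk. *)

definition beurling_sobolev :: "ennreal \<Rightarrow> real \<Rightarrow> (complex \<Rightarrow> complex) set" where
  "beurling_sobolev q \<gamma> = {f \<in> extensional (ball 0 1).
     f holomorphic_on ball 0 1 \<and> taylor_coeff f \<in> weighted_lp q \<gamma>}"

definition beurling_sobolev_norm :: "ennreal \<Rightarrow> real \<Rightarrow> (complex \<Rightarrow> complex) \<Rightarrow> real" where
  "beurling_sobolev_norm q \<gamma> f = weighted_lp_norm q \<gamma> (taylor_coeff f)"

(* The moment sequence j \<mapsto> \<Sum>i\<le>n. \<alpha> i * z i ^ j (with 0 ^ 0 = 1) of points of the disk decays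
   geometrically, so weighted_lp_norm is always meaningful on it. *)

lemma power_sums_in_weighted_lp:
  fixes z \<alpha> :: "nat \<Rightarrow> complex"
  assumes p: "1 \<le> p" and z: "\<And>i. i \<in> {1..n} \<Longrightarrow> norm (z i) < 1"
  shows "(\<lambda>j. \<Sum>i=1..n. \<alpha> i * z i ^ j) \<in> weighted_lp p \<beta>"
proof -
  define r where "r = Max (insert (1/2) ((\<lambda>i. norm (z i)) ` {1..n}))"
  define s where "s = sqrt r"
  define A where "A = (\<Sum>i=1..n. norm (\<alpha> i))"
  define a where "a = (\<lambda>j. \<Sum>i=1..n. \<alpha> i * z i ^ j)"
  have "r < 1"
    using z by (simp add: r_def)
  moreover have "1/2 \<le> r"
    unfolding r_def by (intro Max_ge) auto
  ultimately have "r < 1" "1/2 \<le> r"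
    by simp_all
  hence s: "0 < s" "s < 1" "r = s * s"
    by (auto simp: s_def)
  have A: "0 \<le> A"
    by (simp add: A_def sum_nonneg)
  have a: "norm (a j) \<le> A * (s ^ j * s ^ j)" for j
  proof -
    have "norm (z i) \<le> r" if "i \<in> {1..n}" for i
      unfolding r_def using that by (intro Max_ge) auto
    hence "norm (a j) \<le> (\<Sum>i=1..n. norm (\<alpha> i) * r ^ j)"
      unfolding a_def
      by (intro sum_norm_le) (auto simp: norm_mult norm_power intro!: mult_left_mono power_mono)
    thus ?thesis
      by (simp add: A_def sum_distrib_right s(3) power_mult_distrib)
  qed
  have w0: "0 \<le> weight \<beta> j" for j
    by (simp add: weight_def)
  have "(\<lambda>j. real j powr \<beta> * s ^ j) \<longlonglongrightarrow> 0"
    using s(1,2) by real_asymp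
  hence "(\<lambda>j. weight \<beta> j * s ^ j) \<longlonglongrightarrow> 0"
    by (rule Lim_transform_eventually)
       (auto simp: weight_def intro!: eventually_mono[OF eventually_gt_at_top[of 0]])
  hence "Bseq (\<lambda>j. weight \<beta> j * s ^ j)"
    by (intro convergent_imp_Bseq) (auto simp: convergent_def)
  then obtain B where B: "0 < B" "\<And>j. norm (weight \<beta> j * s ^ j) \<le> B"
    by (auto elim: BseqE)
  have bound: "norm (a j) * weight \<beta> j \<le> A * B * s ^ j" for j
  proof -
    have "norm (a j) * weight \<beta> j \<le> A * (s ^ j * s ^ j) * weight \<beta> j"
      using a w0 by (intro mult_right_mono)
    also have "\<dots> = A * s ^ j * (weight \<beta> j * s ^ j)"
      by simp
    also have "\<dots> \<le> A * s ^ j * B"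
      using B(2)[of j] A s by (intro mult_left_mono) auto
    finally show ?thesis by (simp add: mult_ac)
  qed
  have "a \<in> weighted_lp p \<beta>"
  proof (cases "p = \<infinity>")
    case True
    have "norm (a j) * weight \<beta> j \<le> A * B" for j
    proof -
      have "A * B * s ^ j \<le> A * B * 1"
        using A B(1) s by (intro mult_left_mono power_le_one) auto
      with bound[of j] show ?thesis by simp
    qed
    thus ?thesis
      using True by (auto simp: weighted_lp_def intro!: bdd_aboveI[of _ "A * B"])
  next
    case False
    define t where "t = enn2real p"
    have t: "0 < t"
      using False less_le_trans[OF zero_less_one p]
      by (simp add: t_def enn2real_positive_iff less_top)
    have "s powr t < 1"
      using powr_less_mono2[of t s 1] s t by simp
    hence "summable (\<lambda>j. (A * B) powr t * (s powr t) ^ j)"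
      by (intro summable_mult summable_geometric) simp
    moreover have "norm (norm (a j) powr t * weight \<beta> j powr t) \<le> (A * B) powr t * (s powr t) ^ j" for j
    proof -
      have "norm (norm (a j) powr t * weight \<beta> j powr t) = (norm (a j) * weight \<beta> j) powr t"
        using w0 by (simp add: powr_mult)
      also have "\<dots> \<le> (A * B * s ^ j) powr t"
        using bound w0 t by (intro powr_mono2) auto
      also have "\<dots> = (A * B) powr t * (s powr t) ^ j"
      proof -
        have "(s ^ j) powr t = (s powr t) ^ j"
          using s(1) by (simp add: powr_powr mult.commute flip: powr_realpow)
        thus ?thesis
          using A B(1) s by (simp add: powr_mult)
      qed
      finally show ?thesis .
    qed
    ultimately have "summable (\<lambda>j. norm (a j) powr t * weight \<beta> j powr t)"
      by (rule summable_comparison_test')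
    thus ?thesis
      using False by (simp add: weighted_lp_def t_def)
  qed
  thus ?thesis by (simp add: a_def)
qed

end

(* The hypothesis bounds a linear functional of the moment sequences of finite combinations of the
   nodes by C times the weighted l^p norm.  Hahn-Banach is not needed: the ball of radius C of the
   weighted l^q space is convex and compact for coordinatewise convergence, and evaluation at a
   point of the disk is continuous on it.  For finitely many nodes, minimise the squared distance
   between the values at the nodes and w over this ball; if the residual v were nonzero, the
   coefficients cnj v would violate the hypothesis, because C times the l^p norm of a moment
   sequence is the supremum of its pairing with the ball.  Compactness then gives one element
   interpolating at all nodes.  Uniqueness is the identity theorem and the final inequality is
   Hoelder's. *)
theory Submission
  imports Defs
begin

section \<open>Balls of the weighted sequence spaces: compactness and convexity\<close>

lemma weight_pos [simp]: "0 < weight \<gamma> j"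
  by (simp add: weight_def)

lemma weight_nonneg [simp]: "0 \<le> weight \<gamma> j"
  by (simp add: weight_def)

lemma weight_nonzero [simp]: "weight \<gamma> j \<noteq> 0"
  by (simp add: weight_def)

lemma weight_minus: "weight (- \<gamma>) j = inverse (weight \<gamma> j)"
  by (simp add: weight_def powr_minus)

text \<open>Membership is required separately because the norm is a junk value outside
  \<open>weighted_lp\<close>, so a bound on it alone would say nothing.\<close>

definition lp_cball :: "ennreal \<Rightarrow> real \<Rightarrow> real \<Rightarrow> (nat \<Rightarrow> complex) set" where
  "lp_cball q \<gamma> C = {b \<in> weighted_lp q \<gamma>. weighted_lp_norm q \<gamma> b \<le> C}"

lemma lp_cball_top:
  "lp_cball top \<gamma> C = {b. \<forall>j. norm (b j) * weight \<gamma> j \<le> C}" (is "_ = ?R")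
proof (intro equalityI subsetI)
  fix b assume b: "b \<in> lp_cball top \<gamma> C"
  hence "norm (b j) * weight \<gamma> j \<le> (SUP j. norm (b j) * weight \<gamma> j)" for j
    by (intro cSUP_upper) (auto simp: lp_cball_def weighted_lp_def)
  moreover have "(SUP j. norm (b j) * weight \<gamma> j) \<le> C"
    using b by (simp add: lp_cball_def weighted_lp_norm_def)
  ultimately show "b \<in> ?R"
    using order_trans by blast
next
  fix b assume "b \<in> ?R"
  thus "b \<in> lp_cball top \<gamma> C"
    by (auto simp: lp_cball_def weighted_lp_def weighted_lp_norm_def
             intro!: cSUP_least bdd_aboveI[of _ C])
qed

lemma powr_le_powr_imp_le:
  fixes x C r :: real
  assumes "x powr r \<le> C powr r" "0 < r" "0 \<le> C"
  shows "x \<le> C"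
  using assms powr_less_mono2[of r C x] by linarith

lemma weighted_lp_iff_summable:
  assumes "0 < r"
  shows "a \<in> weighted_lp (ennreal r) \<gamma> \<longleftrightarrow> summable (\<lambda>j. (norm (a j) * weight \<gamma> j) powr r)"
  using assms by (simp add: weighted_lp_def powr_mult)

lemma weighted_lp_norm_powr:
  assumes "0 < r" "a \<in> weighted_lp (ennreal r) \<gamma>"
  shows "weighted_lp_norm (ennreal r) \<gamma> a powr r = (\<Sum>j. (norm (a j) * weight \<gamma> j) powr r)"
  using assms suminf_nonneg[of "\<lambda>j. (norm (a j) * weight \<gamma> j) powr r"]
  by (simp add: weighted_lp_norm_def weighted_lp_def powr_mult powr_powr)

lemma weighted_lp_norm_nonneg: "0 < r \<Longrightarrow> 0 \<le> weighted_lp_norm (ennreal r) \<gamma> a"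
  by (simp add: weighted_lp_norm_def)

lemma sum_le_weighted_lp_norm_powr:
  assumes "0 < r" "a \<in> weighted_lp (ennreal r) \<gamma>"
  shows "(\<Sum>j<N. (norm (a j) * weight \<gamma> j) powr r) \<le> weighted_lp_norm (ennreal r) \<gamma> a powr r"
  using assms unfolding weighted_lp_norm_powr[OF assms]
  by (intro sum_le_suminf) (auto simp: weighted_lp_iff_summable)

text \<open>Partial sums replace the series, so that each condition involves only finitely many
  coordinates. Closedness, convexity and membership of explicit sequences are all read off this
  form.\<close>

lemma lp_cball_finite:
  assumes r: "0 < r" and C: "0 \<le> C"
  shows "lp_cball (ennreal r) \<gamma> C = {b. \<forall>N. (\<Sum>j<N. (norm (b j) * weight \<gamma> j) powr r) \<le> C powr r}"
    (is "_ = ?R")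
proof (intro equalityI subsetI)
  fix b assume b: "b \<in> lp_cball (ennreal r) \<gamma> C"
  hence "weighted_lp_norm (ennreal r) \<gamma> b powr r \<le> C powr r"
    using r by (intro powr_mono2) (auto simp: lp_cball_def weighted_lp_norm_nonneg)
  moreover have "b \<in> weighted_lp (ennreal r) \<gamma>"
    using b by (simp add: lp_cball_def)
  ultimately have "(\<Sum>j<N. (norm (b j) * weight \<gamma> j) powr r) \<le> C powr r" for N
    using sum_le_weighted_lp_norm_powr[OF r] order_trans by blast
  thus "b \<in> ?R" by simp
next
  fix b assume b: "b \<in> ?R"
  hence s: "summable (\<lambda>j. (norm (b j) * weight \<gamma> j) powr r)"
    by (intro summableI_nonneg_bounded[of _ "C powr r"]) auto
  hence l: "b \<in> weighted_lp (ennreal r) \<gamma>"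
    using r by (simp add: weighted_lp_iff_summable)
  have "weighted_lp_norm (ennreal r) \<gamma> b powr r \<le> C powr r"
    unfolding weighted_lp_norm_powr[OF r l] using b s by (intro suminf_le_const) auto
  hence "weighted_lp_norm (ennreal r) \<gamma> b \<le> C"
    using r C by (rule powr_le_powr_imp_le)
  thus "b \<in> lp_cball (ennreal r) \<gamma> C"
    using l by (simp add: lp_cball_def)
qed

lemma ennreal_ge_1_cases:
  assumes "1 \<le> q"
  obtains "q = \<infinity>" | r where "1 \<le> r" "q = ennreal r"
proof (cases q)
  case (real r)
  thus thesis using assms that(2)[of r] by simp
qed (use that(1) in auto)

text \<open>One term is at most the whole sum. The bound provides both the compact box around the
  ball and the majorant for its power series.\<close>

lemma lp_cball_coord:
  assumes "1 \<le> q" "0 \<le> C" "b \<in> lp_cball q \<gamma> C"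
  shows "norm (b j) * weight \<gamma> j \<le> C"
  using assms(1)
proof (cases rule: ennreal_ge_1_cases)
  case 1
  thus ?thesis using assms by (simp add: lp_cball_top)
next
  case (2 r)
  have "\<forall>N. (\<Sum>i<N. (norm (b i) * weight \<gamma> i) powr r) \<le> C powr r"
    using assms(2,3) 2 lp_cball_finite[of r C \<gamma>] by simp
  hence "(\<Sum>i<Suc j. (norm (b i) * weight \<gamma> i) powr r) \<le> C powr r" ..
  moreover have "(norm (b j) * weight \<gamma> j) powr r \<le> (\<Sum>i<Suc j. (norm (b i) * weight \<gamma> i) powr r)"
    by (intro member_le_sum) auto
  ultimately have "(norm (b j) * weight \<gamma> j) powr r \<le> C powr r"
    by linarith
  thus ?thesis
    using 2 assms(2) by (auto elim!: powr_le_powr_imp_le)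
qed

text \<open>Closedness refers to the product topology: the ball is an intersection of closed
  conditions, each on finitely many coordinates.\<close>

lemma closed_lp_cball:
  assumes "1 \<le> q" "0 \<le> C"
  shows "closed (lp_cball q \<gamma> C)"
  using assms(1)
proof (cases rule: ennreal_ge_1_cases)
  case 1
  thus ?thesis
    by (auto simp: lp_cball_top intro!: closed_Collect_all closed_Collect_le continuous_intros)
next
  case (2 r)
  have "continuous_on UNIV (\<lambda>b::nat \<Rightarrow> complex. (norm (b j) * weight \<gamma> j) powr r)" for j
    \<comment> \<open>The base may be 0; continuity there relies on the exponent being
      positive.\<close>
    using 2 by (intro continuous_on_powr' continuous_intros) auto
  hence "continuous_on UNIV (\<lambda>b::nat \<Rightarrow> complex. \<Sum>j<N. (norm (b j) * weight \<gamma> j) powr r)" for N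
    by (rule continuous_on_sum)
  hence "closed {b::nat \<Rightarrow> complex. (\<Sum>j<N. (norm (b j) * weight \<gamma> j) powr r) \<le> C powr r}" for N
    by (rule closed_Collect_le) (rule continuous_on_const)
  hence "closed {b::nat \<Rightarrow> complex. \<forall>N. (\<Sum>j<N. (norm (b j) * weight \<gamma> j) powr r) \<le> C powr r}"
    by (rule closed_Collect_all)
  thus ?thesis
    using 2 assms(2) by (simp add: lp_cball_finite)
qed

text \<open>Tychonoff: the ball is a closed subset of a product of closed discs, whose radii come
  from the coordinate bound.\<close>

lemma compact_lp_cball:
  assumes "1 \<le> q" "0 \<le> C"
  shows "compact (lp_cball q \<gamma> C)"
proof -
  define K where "K = (\<Pi>\<^sub>E j\<in>UNIV. cball (0::complex) (C / weight \<gamma> j))"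
  have "compactin (product_topology (\<lambda>_. euclidean) UNIV) K"
    by (simp add: K_def compactin_PiE)
  hence "compact K"
    by (simp add: euclidean_product_topology)
  moreover have "lp_cball q \<gamma> C \<subseteq> K"
    using lp_cball_coord[OF assms] by (auto simp: K_def PiE_def pos_le_divide_eq)
  ultimately show ?thesis
    using closed_lp_cball[OF assms] by (metis compact_Int_closed inf.absorb_iff2)
qed

text \<open>Convexity of the power is invoked for positive arguments. If one argument is 0, the
  claim reduces to \<open>s powr r\<close> being at most \<open>s\<close> on the unit
  interval.\<close>

lemma convex_combination_powr_le:
  fixes x y t r :: real
  assumes "1 \<le> r" "0 \<le> x" "0 \<le> y" "0 \<le> t" "t \<le> 1"
  shows "((1 - t) * x + t * y) powr r \<le> (1 - t) * x powr r + t * y powr r"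
proof -
  have scale: "(s * u) powr r \<le> s * u powr r" if "0 \<le> s" "s \<le> 1" "0 \<le> u" for s u :: real
  proof -
    have "s powr r \<le> s"
      using that assms(1) powr_mono'[of 1 r s] by (cases "s = 0") auto
    thus ?thesis
      using that by (simp add: powr_mult mult_right_mono)
  qed
  consider "x = 0" | "y = 0" | "0 < x" "0 < y"
    using assms by fastforce
  thus ?thesis
  proof cases
    case 1
    thus ?thesis using scale[of t y] assms by simp
  next
    case 2
    thus ?thesis using scale[of "1 - t" x] assms by simp
  next
    case 3
    thus ?thesis
      using convex_onD[OF powr_convex[OF assms(1)], of t x y] assms by simp
  qed
qed

text \<open>Minkowski's inequality is avoided: the r-th power is convex, so the bound
  \<open>C powr r\<close> on the partial sums survives convex combinations term by term.\<close>

lemma lp_cball_convex: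
  assumes q: "1 \<le> q" and C: "0 \<le> C" and t: "0 \<le> t" "t \<le> 1"
    and b: "b \<in> lp_cball q \<gamma> C" "c \<in> lp_cball q \<gamma> C"
  shows "(\<lambda>j. of_real (1 - t) * b j + of_real t * c j) \<in> lp_cball q \<gamma> C"
proof -
  define d where "d = (\<lambda>j. of_real (1 - t) * b j + of_real t * c j)"
  have d: "norm (d j) * weight \<gamma> j \<le> (1 - t) * (norm (b j) * weight \<gamma> j) + t * (norm (c j) * weight \<gamma> j)" for j
  proof -
    have "norm (d j) \<le> (1 - t) * norm (b j) + t * norm (c j)"
      unfolding d_def using t by (intro norm_triangle_le) (simp add: norm_mult del: of_real_diff)
    hence "norm (d j) * weight \<gamma> j \<le> ((1 - t) * norm (b j) + t * norm (c j)) * weight \<gamma> j"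
      by (intro mult_right_mono) auto
    thus ?thesis by (simp add: algebra_simps)
  qed
  have "d \<in> lp_cball q \<gamma> C"
    using q
  proof (cases rule: ennreal_ge_1_cases)
    case 1
    have "norm (d j) * weight \<gamma> j \<le> (1 - t) * C + t * C" for j
      using b t by (intro order_trans[OF d] add_mono mult_left_mono) (auto simp: 1 lp_cball_top)
    thus ?thesis by (simp add: 1 lp_cball_top algebra_simps)
  next
    case (2 r)
    note fin = lp_cball_finite[of r C \<gamma>]
    have "(\<Sum>j<N. (norm (d j) * weight \<gamma> j) powr r) \<le> C powr r" for N
    proof -
      have "(\<Sum>j<N. (norm (d j) * weight \<gamma> j) powr r)
          \<le> (\<Sum>j<N. (1 - t) * (norm (b j) * weight \<gamma> j) powr r + t * (norm (c j) * weight \<gamma> j) powr r)"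
      proof (intro sum_mono)
        fix j
        show "(norm (d j) * weight \<gamma> j) powr r
            \<le> (1 - t) * (norm (b j) * weight \<gamma> j) powr r + t * (norm (c j) * weight \<gamma> j) powr r"
          using d[of j] 2 t
          by (intro order_trans[OF powr_mono2 convex_combination_powr_le]) auto
      qed
      also have "\<dots> = (1 - t) * (\<Sum>j<N. (norm (b j) * weight \<gamma> j) powr r)
          + t * (\<Sum>j<N. (norm (c j) * weight \<gamma> j) powr r)"
        by (simp add: sum.distrib sum_distrib_left)
      also have "\<dots> \<le> (1 - t) * C powr r + t * C powr r"
        using b t 2 C fin by (intro add_mono mult_left_mono) auto
      finally show ?thesis by (simp add: algebra_simps)
    qed
    thus ?thesis using 2 C fin by simp
  qed
  thus ?thesis by (simp add: d_def)
qed

section \<open>Hoelder's inequality and its converse for weighted sequences\<close>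

lemma Holder_sum_le:
  fixes f g :: "'a \<Rightarrow> real"
  assumes pq: "p > 1" "q > 1" "1 / p + 1 / q = 1"
    and fg: "\<And>i. i \<in> I \<Longrightarrow> 0 \<le> f i" "\<And>i. i \<in> I \<Longrightarrow> 0 \<le> g i" and "0 \<le> S" "0 < T"
    and S: "(\<Sum>i\<in>I. f i powr p) \<le> S powr p" and T: "(\<Sum>i\<in>I. g i powr q) \<le> T powr q"
  shows "(\<Sum>i\<in>I. f i * g i) \<le> S * T"
proof (cases "finite I")
  case fin: True
  show ?thesis
  \<comment> \<open>The case \<open>S = 0\<close> arises when the moment sequence vanishes, and then
    normalisation by \<open>S\<close> is impossible.\<close>
  proof (cases "S = 0")
    case True
    hence "(\<Sum>i\<in>I. f i powr p) = 0"
      using S by (intro antisym sum_nonneg) auto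
    hence "f i = 0" if "i \<in> I" for i
      using fin that by (simp add: sum_nonneg_eq_0_iff)
    thus ?thesis using True by simp
  next
    case False
    with \<open>0 \<le> S\<close> have "0 < S" by simp
    \<comment> \<open>Young's inequality for the normalised terms. Upper bounds \<open>S\<close> and
      \<open>T\<close> serve as well as the exact norms, so finite sums can be compared with the
      norm of a whole sequence.\<close>
    have "(\<Sum>i\<in>I. (f i / S) * (g i / T)) \<le> (\<Sum>i\<in>I. (f i / S) powr p / p + (g i / T) powr q / q)"
      using fg \<open>0 < S\<close> \<open>0 < T\<close> pq by (intro sum_mono Youngs_inequality) auto
    also have "\<dots> = (\<Sum>i\<in>I. f i powr p) / S powr p / p + (\<Sum>i\<in>I. g i powr q) / T powr q / q"
      using fg \<open>0 < S\<close> \<open>0 < T\<close> by (simp add: sum.distrib powr_divide sum_divide_distrib)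
    also have "\<dots> \<le> 1 / p + 1 / q"
      using S T pq \<open>0 < S\<close> \<open>0 < T\<close> by (intro add_mono divide_right_mono) auto
    finally have "(\<Sum>i\<in>I. f i * g i) / (S * T) \<le> 1"
      by (simp add: pq sum_divide_distrib)
    thus ?thesis using \<open>0 < S\<close> \<open>0 < T\<close> by simp
  qed
qed (use assms in auto)

text \<open>In \<open>ennreal\<close>, 1 / \<open>top\<close> is 0 and 1 / 0 is \<open>top\<close>.
  The single equation therefore includes both endpoint pairs and excludes
  \<open>p = 0\<close>.\<close>

lemma conjugate_exponent_cases:
  fixes p q :: ennreal
  assumes "1 \<le> q" "1 / p + 1 / q = 1"
  obtains "p = top" "q = 1" | "p = 1" "q = top"
  | r s where "p = ennreal r" "q = ennreal s" "1 < r" "1 < s" "1 / r + 1 / s = 1"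
proof -
  have one_div: "1 / ennreal r = ennreal (1 / r)" if "0 < r" for r
    using that divide_ennreal[of 1 r] by simp
  show thesis
    using assms(1)
  proof (cases rule: ennreal_ge_1_cases)
    case 1
    hence "1 / p = 1"
      using assms(2) by simp
    hence "p = 1"
    proof (cases p)
      case (real r)
      with \<open>1 / p = 1\<close> have "r \<noteq> 0"
        by (intro notI) simp
      with real \<open>1 / p = 1\<close> show ?thesis by (simp add: one_div)
    qed simp
    thus thesis using 1 that(2) by simp
  next
    case (2 s)
    hence q: "1 / q = ennreal (1 / s)"
      by (simp add: one_div)
    show thesis
    proof (cases p)
      case (real r)
      have "r \<noteq> 0"
        using assms(2) real by (intro notI) simp
      hence r: "0 < r" using real by simp
      hence "ennreal (1 / r + 1 / s) = 1"
        using assms(2) q real 2 by (simp add: one_div)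
      hence rs: "1 / r + 1 / s = 1"
        by simp
      moreover have "0 < 1 / r" "0 < 1 / s"
        using r 2 by auto
      ultimately have "1 / s < 1" "1 / r < 1" by linarith+
      thus thesis
        using that(3)[of r s] rs r 2 real by simp
    next
      case top
      thus thesis using that(1) q assms(2) 2 by simp
    qed
  qed
qed

text \<open>This phase makes every term of a pairing real and nonnegative; \<open>sgn 0 = 0\<close>
  covers a vanishing entry.\<close>

lemma mult_cnj_sgn: "a * cnj (sgn a) = of_real (norm a)"
  by (cases "a = 0") (simp_all add: sgn_eq complex_norm_square[symmetric] power2_eq_square)

text \<open>The weights for \<open>\<beta>\<close> and \<open>-\<beta>\<close> are reciprocal and
  cancel in each product, which leaves the unweighted inequality in its three exponent
  cases.\<close>

lemma Holder_weighted_lp: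
  assumes q: "1 \<le> q" and pq: "1 / p + 1 / q = 1" and C: "0 < C"
    and a: "a \<in> weighted_lp p \<beta>" and b: "b \<in> lp_cball q (- \<beta>) C"
  shows "(\<Sum>j<N. norm (a j * b j)) \<le> C * weighted_lp_norm p \<beta> a"
proof -
  define A where "A = (\<lambda>j. norm (a j) * weight \<beta> j)"
  define B where "B = (\<lambda>j. norm (b j) * weight (- \<beta>) j)"
  have nonneg: "0 \<le> A j" "0 \<le> B j" for j
    by (simp_all add: A_def B_def)
  have AB: "norm (a j * b j) = A j * B j" for j
    by (simp add: A_def B_def norm_mult weight_minus)
  have "(\<Sum>j<N. A j * B j) \<le> weighted_lp_norm p \<beta> a * C"
    using q pq
  proof (cases rule: conjugate_exponent_cases)
    case 1
    have A: "A j \<le> weighted_lp_norm p \<beta> a" for j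
      using a cSUP_upper[of j UNIV A]
      by (simp add: 1 weighted_lp_def weighted_lp_norm_def A_def)
    have "(\<Sum>j<N. A j * B j) \<le> (\<Sum>j<N. weighted_lp_norm p \<beta> a * B j)"
      using A nonneg by (intro sum_mono mult_right_mono)
    also have "\<dots> = weighted_lp_norm p \<beta> a * (\<Sum>j<N. B j)"
      by (simp add: sum_distrib_left)
    also have "\<dots> \<le> weighted_lp_norm p \<beta> a * C"
    proof (intro mult_left_mono)
      show "(\<Sum>j<N. B j) \<le> C"
        using b C lp_cball_finite[of 1 C "- \<beta>"] by (simp add: 1 B_def)
      show "0 \<le> weighted_lp_norm p \<beta> a"
        using A[of 0] nonneg(1)[of 0] by linarith
    qed
    finally show ?thesis .
  next
    case 2
    have B: "B j \<le> C" for j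
      using b by (simp add: 2 lp_cball_top B_def)
    have "(\<Sum>j<N. A j * B j) \<le> (\<Sum>j<N. A j * C)"
      using B nonneg by (intro sum_mono mult_left_mono)
    also have "\<dots> = (\<Sum>j<N. A j) * C"
      by (simp add: sum_distrib_right)
    also have "\<dots> \<le> weighted_lp_norm p \<beta> a * C"
      using sum_le_weighted_lp_norm_powr[of 1 a \<beta> N] a C weighted_lp_norm_nonneg[of 1 \<beta> a]
      by (intro mult_right_mono) (auto simp: 2 A_def)
    finally show ?thesis .
  next
    case (3 r s)
    have "(\<Sum>j<N. A j powr r) \<le> weighted_lp_norm p \<beta> a powr r"
      using sum_le_weighted_lp_norm_powr[of r a \<beta> N] a 3 by (simp add: A_def)
    moreover have "(\<Sum>j<N. B j powr s) \<le> C powr s"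
      using b C 3 lp_cball_finite[of s C "- \<beta>"] by (simp add: B_def)
    ultimately show ?thesis
      using 3 C nonneg weighted_lp_norm_nonneg[of r \<beta> a]
      by (intro Holder_sum_le[of r s]) auto
  qed
  thus ?thesis by (simp add: AB mult.commute)
qed

lemma norm_pairing_le:
  assumes "1 \<le> q" "1 / p + 1 / q = 1" "0 < C"
    and "a \<in> weighted_lp p \<beta>" "b \<in> lp_cball q (- \<beta>) C"
  shows "norm (\<Sum>j. a j * b j) \<le> C * weighted_lp_norm p \<beta> a"
proof -
  note le = Holder_weighted_lp[OF assms]
  hence "summable (\<lambda>j. norm (a j * b j))"
    by (intro summableI_nonneg_bounded) auto
  with le show ?thesis
    by (intro order_trans[OF summable_norm] suminf_le_const)
qed

(* Only an inequality in the first bound: where a vanishes, b does too, whatever the exponent. *)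
lemma norming_sequence:
  assumes r: "0 < r" and a: "a \<in> weighted_lp (ennreal r) \<beta>"
    and S: "0 < weighted_lp_norm (ennreal r) \<beta> a" and C: "0 < C"
  obtains b where
    "\<And>j. norm (b j) * weight (- \<beta>) j
       \<le> C * (norm (a j) * weight \<beta> j / weighted_lp_norm (ennreal r) \<beta> a) powr (r - 1)"
    "(\<Sum>j. a j * b j) = of_real (C * weighted_lp_norm (ennreal r) \<beta> a)"
proof -
  define T where "T = weighted_lp_norm (ennreal r) \<beta> a"
  define A where "A = (\<lambda>j. norm (a j) * weight \<beta> j)"
  \<comment> \<open>The equality case of Hoelder: after removal of the weights the modulus is
    proportional to \<open>A j powr (r - 1)\<close>, and the phase is opposite to that of
    \<open>a j\<close>. The factor \<open>weight \<beta> j\<close> offsets the reciprocal weight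
    that measures \<open>b\<close>.\<close>
  define b where "b = (\<lambda>j. of_real (C * (A j / T) powr (r - 1) * weight \<beta> j) * cnj (sgn (a j)))"
  have "norm (b j) * weight (- \<beta>) j \<le> C * (A j / T) powr (r - 1)" for j
  proof -
    have "norm (b j) * weight (- \<beta>) j = C * (A j / T) powr (r - 1) * norm (sgn (a j))"
      using C by (simp add: b_def norm_mult weight_minus)
    also have "\<dots> \<le> C * (A j / T) powr (r - 1) * 1"
      using C by (intro mult_left_mono) (auto simp: norm_sgn)
    finally show ?thesis by simp
  qed
  moreover have "(\<lambda>j. a j * b j) sums of_real (C * T)"
  proof -
    have "a j * b j = of_real (C * T / T powr r * (A j powr r))" for j
    proof -
      have "a j * b j = of_real (C * (A j / T) powr (r - 1) * weight \<beta> j) * (a j * cnj (sgn (a j)))"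
        by (simp add: b_def)
      also have "\<dots> = of_real (C * ((A j / T) powr (r - 1) * A j))"
        unfolding mult_cnj_sgn by (simp add: A_def)
      also have "(A j / T) powr (r - 1) * A j = T / T powr r * A j powr r"
      proof (cases "a j = 0")
        case False
        hence "0 < A j" by (simp add: A_def)
        thus ?thesis using S by (simp add: powr_divide powr_diff T_def)
      qed (use r in \<open>simp add: A_def\<close>)
      finally show ?thesis by (simp add: mult.assoc)
    qed
    moreover have "(\<lambda>j. A j powr r) sums (T powr r)"
      using r a by (simp add: T_def A_def weighted_lp_norm_powr weighted_lp_iff_summable summable_sums)
    hence "(\<lambda>j. C * T / T powr r * (A j powr r)) sums (C * T / T powr r * T powr r)"
      by (rule sums_mult)
    hence "(\<lambda>j. C * T / T powr r * (A j powr r)) sums (C * T)"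
      using S by (simp add: T_def)
    ultimately show ?thesis
      by (simp only: sums_of_real)
  qed
  ultimately show thesis
    using that[of b] by (simp add: sums_iff A_def T_def)
qed

text \<open>Converse of Hoelder. For finite \<open>p\<close> one element of the ball attains the
  value; for \<open>p = top\<close> the supremum need not be attained, so each coordinate is tested
  by a sequence supported there.\<close>

lemma weighted_lp_norm_le_dual:
  assumes q: "1 \<le> q" and pq: "1 / p + 1 / q = 1" and C: "0 < C"
    and a: "a \<in> weighted_lp p \<beta>"
    and M: "\<And>b. b \<in> lp_cball q (- \<beta>) C \<Longrightarrow> Re (\<Sum>j. a j * b j) \<le> M"
  shows "C * weighted_lp_norm p \<beta> a \<le> M"
  using q pq
proof (cases rule: conjugate_exponent_cases)
  case 1
  have "norm (a i) * weight \<beta> i \<le> M / C" for i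
  proof -
    define b where "b = (\<lambda>j. if j = i then of_real (C * weight \<beta> i) * cnj (sgn (a i)) else 0)"
    have "norm (b j) * weight (- \<beta>) j \<le> (if j = i then C else 0)" for j
      using C by (simp add: b_def norm_mult weight_minus norm_sgn)
    hence "(\<Sum>j<N. norm (b j) * weight (- \<beta>) j) \<le> (\<Sum>j<N. if j = i then C else 0)" for N
      by (intro sum_mono)
    also have "(\<Sum>j<N. if j = i then C else 0) \<le> C" for N
      using C by simp
    finally have "b \<in> lp_cball q (- \<beta>) C"
      using C lp_cball_finite[of 1 C "- \<beta>"] by (simp add: 1)
    moreover have "(\<Sum>j. a j * b j) = of_real (C * (norm (a i) * weight \<beta> i))"
    proof -
      have "(\<Sum>j. a j * b j) = a i * b i"
        by (subst suminf_finite[of "{i}"]) (auto simp: b_def)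
      also have "\<dots> = of_real (C * weight \<beta> i) * (a i * cnj (sgn (a i)))"
        by (simp add: b_def)
      finally show ?thesis
        unfolding mult_cnj_sgn by simp
    qed
    ultimately have "C * (norm (a i) * weight \<beta> i) \<le> M"
      using M[of b] by simp
    thus ?thesis
      using C by (simp add: pos_le_divide_eq mult_ac)
  qed
  hence "weighted_lp_norm p \<beta> a \<le> M / C"
    by (auto simp: 1 weighted_lp_norm_def intro!: cSUP_least)
  thus ?thesis
    using C by (simp add: pos_le_divide_eq mult_ac)
next
  case 2
  show ?thesis
  proof (cases "weighted_lp_norm p \<beta> a = 0")
    case True
    \<comment> \<open>With norm 0 there is nothing to normalise; the zero sequence gives that
      \<open>M\<close> is nonnegative, which is the claim.\<close>
    have "(\<lambda>_. 0) \<in> lp_cball q (- \<beta>) C"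
      using C by (simp add: 2 lp_cball_top)
    thus ?thesis using M[of "\<lambda>_. 0"] True by simp
  next
    case False
    hence S: "0 < weighted_lp_norm (ennreal 1) \<beta> a"
      using weighted_lp_norm_nonneg[of 1 \<beta> a] 2 by simp
    obtain b where b: "\<And>j. norm (b j) * weight (- \<beta>) j
        \<le> C * (norm (a j) * weight \<beta> j / weighted_lp_norm (ennreal 1) \<beta> a) powr (1 - 1)"
      "(\<Sum>j. a j * b j) = of_real (C * weighted_lp_norm (ennreal 1) \<beta> a)"
      using norming_sequence[OF _ _ S C] a 2 by auto
    \<comment> \<open>\<open>x powr 0\<close> is 0 at \<open>x = 0\<close> and 1 elsewhere; the
      bound holds in both cases.\<close>
    have "norm (b j) * weight (- \<beta>) j \<le> C" for j
      using b(1)[of j] C by (auto simp: powr_zero_eq_one split: if_splits)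
    hence "b \<in> lp_cball q (- \<beta>) C"
      by (simp add: 2 lp_cball_top)
    from M[OF this] show ?thesis
      using b(2) 2 by simp
  qed
next
  case (3 r s)
  show ?thesis
  proof (cases "weighted_lp_norm p \<beta> a = 0")
    case True
    have "(\<lambda>_. 0) \<in> lp_cball q (- \<beta>) C"
      using C 3 lp_cball_finite[of s C "- \<beta>"] by simp
    thus ?thesis using M[of "\<lambda>_. 0"] True by simp
  next
    case False
    define T where "T = weighted_lp_norm (ennreal r) \<beta> a"
    have T: "0 < T"
      using weighted_lp_norm_nonneg[of r \<beta> a] 3 False by (simp add: T_def)
    obtain b where b: "\<And>j. norm (b j) * weight (- \<beta>) j
        \<le> C * (norm (a j) * weight \<beta> j / T) powr (r - 1)"
      "(\<Sum>j. a j * b j) = of_real (C * T)"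
      using norming_sequence[of r a \<beta> C] a 3 C T unfolding T_def by auto
    \<comment> \<open>Conjugacy turns the s-th power of \<open>b\<close> back into the r-th power of
      \<open>a\<close>, whose partial sums are at most \<open>T powr r\<close>.\<close>
    have rs: "(r - 1) * s = r"
      using 3 by (simp add: field_simps)
    have "(\<Sum>j<N. (norm (b j) * weight (- \<beta>) j) powr s) \<le> C powr s" for N
    proof -
      have "(\<Sum>j<N. (norm (b j) * weight (- \<beta>) j) powr s)
          \<le> (\<Sum>j<N. C powr s / T powr r * (norm (a j) * weight \<beta> j) powr r)"
      proof (intro sum_mono)
        fix j
        have "(norm (b j) * weight (- \<beta>) j) powr s
            \<le> (C * (norm (a j) * weight \<beta> j / T) powr (r - 1)) powr s"
          using b(1)[of j] 3 by (intro powr_mono2) auto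
        also have "\<dots> = C powr s * (norm (a j) * weight \<beta> j / T) powr r"
          using C by (simp add: powr_mult powr_powr rs)
        also have "\<dots> = C powr s / T powr r * (norm (a j) * weight \<beta> j) powr r"
          using T by (simp add: powr_divide)
        finally show "(norm (b j) * weight (- \<beta>) j) powr s
            \<le> C powr s / T powr r * (norm (a j) * weight \<beta> j) powr r" .
      qed
      also have "\<dots> = C powr s / T powr r * (\<Sum>j<N. (norm (a j) * weight \<beta> j) powr r)"
        by (simp add: sum_distrib_left)
      also have "\<dots> \<le> C powr s / T powr r * T powr r"
        unfolding T_def using a 3
        by (intro mult_left_mono sum_le_weighted_lp_norm_powr) auto
      finally show ?thesis using T by simp
    qed
    hence "b \<in> lp_cball q (- \<beta>) C"
      using C 3 lp_cball_finite[of s C "- \<beta>"] by simp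
    from M[OF this] show ?thesis
      using b(2) 3 by (simp add: T_def)
  qed
qed

section \<open>Interpolation at finitely many nodes by least squares\<close>

lemma norm_diff_of_real_mult_squared:
  "(norm (v - of_real t * u))\<^sup>2 = (norm v)\<^sup>2 - 2 * t * Re (cnj v * u) + t\<^sup>2 * (norm u)\<^sup>2"
  for u v :: complex and t :: real
  unfolding cmod_power2 by (simp add: power2_eq_square algebra_simps)

text \<open>A point of a finite-dimensional space that satisfies every half-space inequality valid
  on a compact convex set lies in the set. Convexity is asked only of the value vectors
  \<open>L i x\<close>, so \<open>K\<close> carries no linear structure.\<close>

lemma exists_interpolant_if_dominated:
  fixes L :: "'i \<Rightarrow> 'a::topological_space \<Rightarrow> complex"
  assumes K: "compact K" "K \<noteq> {}" and I: "finite I"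
    and cont: "\<And>i. i \<in> I \<Longrightarrow> continuous_on K (L i)"
    and convex: "\<And>x y t. \<lbrakk>x \<in> K; y \<in> K; 0 \<le> t; t \<le> 1\<rbrakk> \<Longrightarrow>
      \<exists>z\<in>K. \<forall>i\<in>I. L i z = L i x + of_real t * (L i y - L i x)"
    and dominated: "\<And>\<alpha> M. (\<And>x. x \<in> K \<Longrightarrow> Re (\<Sum>i\<in>I. \<alpha> i * L i x) \<le> M) \<Longrightarrow>
      Re (\<Sum>i\<in>I. \<alpha> i * w i) \<le> M"
  obtains x where "x \<in> K" "\<And>i. i \<in> I \<Longrightarrow> L i x = w i"
proof -
  define F where "F = (\<lambda>x. \<Sum>i\<in>I. (norm (w i - L i x))\<^sup>2)"
  have "continuous_on K F"
    unfolding F_def by (intro continuous_intros cont)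
  from continuous_attains_inf[OF K this] obtain x where x: "x \<in> K" "\<And>y. y \<in> K \<Longrightarrow> F x \<le> F y"
    by blast
  define v where "v = (\<lambda>i. w i - L i x)"
  \<comment> \<open>First-order condition at the minimiser: the functional with coefficients
    \<open>cnj (v i)\<close> attains its maximum over \<open>K\<close> at \<open>x\<close>.\<close>
  have le: "Re (\<Sum>i\<in>I. cnj (v i) * L i y) \<le> Re (\<Sum>i\<in>I. cnj (v i) * L i x)" if y: "y \<in> K" for y
  proof -
    define u where "u = (\<lambda>i. L i y - L i x)"
    define R where "R = (\<Sum>i\<in>I. Re (cnj (v i) * u i))"
    define U where "U = (\<Sum>i\<in>I. (norm (u i))\<^sup>2)"
    have "0 \<le> U"
      unfolding U_def by (intro sum_nonneg) auto
    \<comment> \<open>A move from \<open>x\<close> towards \<open>y\<close> by the fraction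
      \<open>t\<close> cannot decrease \<open>F\<close>; the squares are expanded.\<close>
    have quad: "2 * t * R \<le> t\<^sup>2 * U" if t: "0 \<le> t" "t \<le> 1" for t
    proof -
      obtain z where z: "z \<in> K" "\<And>i. i \<in> I \<Longrightarrow> L i z = L i x + of_real t * u i"
        using convex[OF x(1) y t] by (auto simp: u_def)
      have "F z = (\<Sum>i\<in>I. (norm (v i - of_real t * u i))\<^sup>2)"
        unfolding F_def using z(2) by (intro sum.cong refl) (simp add: v_def algebra_simps)
      also have "\<dots> = F x - 2 * t * R + t\<^sup>2 * U"
        unfolding norm_diff_of_real_mult_squared F_def R_def U_def v_def
        by (simp only: sum.distrib sum_subtractf sum_distrib_left)
      finally show ?thesis
        using x(2)[OF z(1)] by simp
    qed
    have "R \<le> 0"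
    proof (rule ccontr)
      assume "\<not> R \<le> 0"
      hence R: "0 < R" by simp
      \<comment> \<open>This \<open>t\<close> lies in the unit interval even for
        \<open>U = 0\<close>, and \<open>t * U\<close> is at most \<open>R\<close>, against the
        bound \<open>2 * R\<close> from below.\<close>
      define t where "t = R / (R + U)"
      have t: "0 < t" "t \<le> 1" "t * (R + U) = R"
        using R \<open>0 \<le> U\<close> by (auto simp: t_def)
      have "t * (2 * R) \<le> t * (t * U)"
        using quad[of t] t by (simp add: power2_eq_square mult_ac)
      hence "2 * R \<le> t * U"
        using t(1) by simp
      moreover have "t * U \<le> R"
        using t(3) mult_pos_pos[OF t(1) R] unfolding distrib_left by linarith
      ultimately show False using R by simp
    qed
    thus ?thesis
      by (simp add: R_def u_def algebra_simps sum_subtractf sum.distrib)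
  qed
  \<comment> \<open>Domination tested on the residual itself; the two sides differ by the squared
    length of \<open>v\<close>, which must then be 0.\<close>
  have "Re (\<Sum>i\<in>I. cnj (v i) * w i) \<le> Re (\<Sum>i\<in>I. cnj (v i) * L i x)"
    by (intro dominated le)
  moreover have "Re (\<Sum>i\<in>I. cnj (v i) * w i) - Re (\<Sum>i\<in>I. cnj (v i) * L i x) = (\<Sum>i\<in>I. (norm (v i))\<^sup>2)"
  proof -
    have "Re (cnj (v i) * w i) - Re (cnj (v i) * L i x) = (norm (v i))\<^sup>2" for i
    proof -
      have "Re (cnj (v i) * w i) - Re (cnj (v i) * L i x) = Re (cnj (v i) * v i)"
        by (simp add: v_def algebra_simps)
      also have "\<dots> = (norm (v i))\<^sup>2"
        unfolding cmod_power2 by (simp add: power2_eq_square)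
      finally show ?thesis .
    qed
    thus ?thesis
      by (simp only: Re_sum flip: sum_subtractf)
  qed
  ultimately have "(\<Sum>i\<in>I. (norm (v i))\<^sup>2) = 0"
    by (intro antisym sum_nonneg) auto
  hence "v i = 0" if "i \<in> I" for i
    using I that by (simp add: sum_nonneg_eq_0_iff)
  thus thesis
    using that[of x] x(1) by (simp add: v_def)
qed

section \<open>Power series with coefficients in the ball\<close>

lemma summable_weight_power:
  fixes z :: complex
  assumes "norm z < 1"
  shows "summable (\<lambda>j. weight \<beta> j * norm z ^ j)"
proof -
  \<comment> \<open>The moment sequence of the single node \<open>z\<close> with coefficient 1,
    taken with exponent 1.\<close>
  have "(\<lambda>j. \<Sum>i=1..1::nat. 1 * z ^ j) \<in> weighted_lp (ennreal 1) \<beta>"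
    by (rule power_sums_in_weighted_lp) (use assms in simp_all)
  thus ?thesis
    by (subst (asm) weighted_lp_iff_summable) (simp_all add: norm_power mult.commute)
qed

context
  fixes q :: ennreal and \<beta> C :: real
  assumes q: "1 \<le> q" and C: "0 \<le> C"
begin

text \<open>The majorant does not depend on \<open>b\<close>, so the series converge uniformly over
  the ball.\<close>

lemma norm_lp_cball_term_le:
  assumes "b \<in> lp_cball q (- \<beta>) C"
  shows "norm (b j * z ^ j) \<le> C * (weight \<beta> j * norm z ^ j)"
proof -
  have "norm (b j) * inverse (weight \<beta> j) \<le> C"
    using lp_cball_coord[OF q C assms, of j] by (simp add: weight_minus)
  hence "norm (b j) \<le> C * weight \<beta> j"
    using weight_pos[of \<beta> j] by (simp add: field_simps)
  thus ?thesis
    by (simp add: norm_mult norm_power mult_right_mono flip: mult.assoc)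
qed

lemma summable_lp_cball:
  assumes "b \<in> lp_cball q (- \<beta>) C" "norm z < 1"
  shows "summable (\<lambda>j. b j * z ^ j)"
  using norm_lp_cball_term_le[OF assms(1)]
  by (rule summable_comparison_test'[OF summable_mult[OF summable_weight_power[OF assms(2)]]])

text \<open>On the ball, evaluation is a uniform limit of partial sums, each continuous because it
  depends on finitely many coordinates.\<close>

lemma continuous_on_lp_cball_eval:
  assumes "norm z < 1"
  shows "continuous_on (lp_cball q (- \<beta>) C) (\<lambda>b. \<Sum>j. b j * z ^ j)"
proof (rule uniform_limit_theorem)
  show "uniform_limit (lp_cball q (- \<beta>) C) (\<lambda>n b. \<Sum>j<n. b j * z ^ j) (\<lambda>b. \<Sum>j. b j * z ^ j) sequentially"
    using norm_lp_cball_term_le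
    by (rule Weierstrass_m_test[OF _ summable_mult[OF summable_weight_power[OF assms]]])
  have "continuous_on (lp_cball q (- \<beta>) C) (\<lambda>b. b j)" for j
    by (rule continuous_on_subset[OF continuous_on_product_coordinates]) simp
  thus "\<forall>\<^sub>F n in sequentially. continuous_on (lp_cball q (- \<beta>) C) (\<lambda>b. \<Sum>j<n. b j * z ^ j)"
    by (intro always_eventually allI continuous_on_sum continuous_on_mult continuous_on_const)
qed simp

text \<open>Exchanging the finite sum with the series turns a combination of point values into the
  pairing of \<open>b\<close> with a moment sequence, to which Hoelder and its converse
  apply.\<close>

lemma sum_lp_cball_eval:
  assumes b: "b \<in> lp_cball q (- \<beta>) C" and z: "\<And>i. i \<in> I \<Longrightarrow> norm (z i) < 1"
  shows "(\<Sum>i\<in>I. \<alpha> i * (\<Sum>j. b j * z i ^ j)) = (\<Sum>j. (\<Sum>i\<in>I. \<alpha> i * z i ^ j) * b j)"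
proof -
  have "(\<Sum>i\<in>I. \<alpha> i * (\<Sum>j. b j * z i ^ j)) = (\<Sum>i\<in>I. \<Sum>j. \<alpha> i * (b j * z i ^ j))"
    using summable_lp_cball[OF b z] by (intro sum.cong refl suminf_mult[symmetric])
  also have "\<dots> = (\<Sum>j. \<Sum>i\<in>I. \<alpha> i * (b j * z i ^ j))"
    using summable_lp_cball[OF b z] by (intro suminf_sum[symmetric] summable_mult)
  finally show ?thesis
    by (simp add: sum_distrib_left sum_distrib_right mult_ac)
qed

text \<open>Passage from sequences back to functions: the radius of convergence is at least 1, and
  uniqueness of the expansion at 0 recovers \<open>b\<close>.\<close>

lemma lp_cball_power_series:
  assumes b: "b \<in> lp_cball q (- \<beta>) C"
  defines "f \<equiv> restrict (\<lambda>z. \<Sum>j. b j * z ^ j) (ball 0 1)"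
  shows "f \<in> beurling_sobolev q (- \<beta>)" "taylor_coeff f = b"
proof -
  have eval: "eval_fps (Abs_fps b) z = (\<Sum>j. b j * z ^ j)" for z
    by (simp add: eval_fps_def)
  have radius: "1 \<le> fps_conv_radius (Abs_fps b)"
    unfolding fps_conv_radius_def
    by (intro conv_radius_geI_ex') (auto intro!: summable_lp_cball[OF b])
  have hol: "f holomorphic_on ball 0 1"
  proof -
    have "eval_fps (Abs_fps b) holomorphic_on ball 0 1"
    proof (intro holomorphic_on_eval_fps subsetI)
      fix z :: complex assume "z \<in> ball 0 1"
      hence "ereal (norm z) < 1" by simp
      thus "z \<in> eball 0 (fps_conv_radius (Abs_fps b))"
        using order_less_le_trans[OF _ radius] by simp
    qed
    thus ?thesis
      by (rule holomorphic_transform) (simp add: f_def eval)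
  qed
  have "f has_fps_expansion Abs_fps b"
    unfolding has_fps_expansion_def
  proof
    show "0 < fps_conv_radius (Abs_fps b)"
      using radius by (rule order_less_le_trans[rotated]) simp
    have "\<forall>\<^sub>F z in nhds 0. z \<in> ball (0::complex) 1"
      by (intro eventually_nhds_in_open) auto
    thus "\<forall>\<^sub>F z in nhds 0. eval_fps (Abs_fps b) z = f z"
      by eventually_elim (simp add: f_def eval)
  qed
  from fps_nth_fps_expansion[OF this] show "taylor_coeff f = b"
    by (auto simp: taylor_coeff_def fps_expansion_def fun_eq_iff)
  thus "f \<in> beurling_sobolev q (- \<beta>)"
    using b hol by (simp add: beurling_sobolev_def lp_cball_def f_def)
qed

end

section \<open>Uniqueness and the interpolation theorem\<close>

lemma beurling_sobolev_eqI:
  assumes f: "f \<in> beurling_sobolev q \<gamma>" and g: "g \<in> beurling_sobolev q \<gamma>"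
    and Z: "Z \<subseteq> ball 0 1" "x \<in> ball 0 1" "x islimpt Z" and eq: "\<And>z. z \<in> Z \<Longrightarrow> f z = g z"
  shows "f = g"
proof (rule extensionalityI)
  show "f \<in> extensional (ball 0 1)" "g \<in> extensional (ball 0 1)"
    using f g by (auto simp: beurling_sobolev_def)
  fix z :: complex assume "z \<in> ball 0 1"
  moreover have "(\<lambda>z. f z - g z) holomorphic_on ball 0 1"
    using f g by (auto simp: beurling_sobolev_def intro!: holomorphic_intros)
  ultimately have "f z - g z = 0"
    using analytic_continuation[of "\<lambda>z. f z - g z" "ball 0 1" Z x z] Z eq by simp
  thus "f z = g z" by simp
qed

theorem theorem9:
  fixes l w :: "nat \<Rightarrow> complex" and C \<beta> :: real and p q :: ennreal
  assumes "inj_on l {1..}" and "\<And>i. i \<ge> 1 \<Longrightarrow> l i \<in> ball 0 1"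
    and "\<exists>x\<in>ball 0 1. x islimpt (l ` {1..})"
    and "C > 0"
    and "1 \<le> q" and "1 / p + 1 / q = 1"
    and "\<And>(n::nat) \<alpha>. n \<ge> 1 \<Longrightarrow>
           norm (\<Sum>i=1..n. \<alpha> i * w i)
             \<le> C * weighted_lp_norm p \<beta> (\<lambda>j. \<Sum>i=1..n. \<alpha> i * l i ^ j)"
  shows "\<exists>f \<in> beurling_sobolev q (-\<beta>).
     ((\<forall>i\<ge>1. f (l i) = w i) \<and> beurling_sobolev_norm q (-\<beta>) f \<le> C)
     \<and> (\<forall>g \<in> beurling_sobolev q (-\<beta>).
          (\<forall>i\<ge>1. g (l i) = w i) \<and> beurling_sobolev_norm q (-\<beta>) g \<le> C \<longrightarrow> g = f)
     \<and> (\<forall>(n::nat) z \<alpha>. n \<ge> 1 \<and> inj_on z {1..} \<and> (\<forall>i\<ge>1. z i \<in> ball 0 1) \<longrightarrow>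
          norm (\<Sum>i=1..n. \<alpha> i * f (z i))
            \<le> C * weighted_lp_norm p \<beta> (\<lambda>j. \<Sum>i=1..n. \<alpha> i * z i ^ j))"
proof -
  define K where "K = lp_cball q (- \<beta>) C"
  define L where "L = (\<lambda>i b. \<Sum>j. b j * l i ^ j)"
  have C: "0 \<le> C" using assms(4) by simp
  have l: "norm (l i) < 1" if "1 \<le> i" for i
    using assms(2)[OF that] by simp
  have p: "1 \<le> p"
    using assms(5,6) by (cases rule: conjugate_exponent_cases) auto
  have K: "compact K"
    unfolding K_def using assms(5) C by (rule compact_lp_cball)
  have cont: "continuous_on K (L i)" if "1 \<le> i" for i
    unfolding K_def L_def using assms(5) C l[OF that] by (rule continuous_on_lp_cball_eval)
  have "(\<lambda>_. 0) \<in> K"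
    using assms(5)
  proof (cases rule: ennreal_ge_1_cases)
    case 1
    thus ?thesis using C by (simp add: K_def lp_cball_top)
  next
    case (2 r)
    thus ?thesis using C by (simp add: K_def lp_cball_finite)
  qed
  have solve: "\<exists>b\<in>K. \<forall>i\<in>{1..n}. L i b = w i" if n: "1 \<le> n" for n
  proof (rule exists_interpolant_if_dominated[of K "{1..n}" L w])
    show "compact K" "K \<noteq> {}" "finite {1..n}"
      using K \<open>(\<lambda>_. 0) \<in> K\<close> by auto
    show "continuous_on K (L i)" if "i \<in> {1..n}" for i
      using cont that by simp
    show "\<exists>d\<in>K. \<forall>i\<in>{1..n}. L i d = L i b + of_real t * (L i c - L i b)"
      if "b \<in> K" "c \<in> K" "0 \<le> t" "t \<le> 1" for b c t
    proof
      \<comment> \<open>Evaluation is linear in the coefficients, so the convex combination of the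
        sequences has the required values.\<close>
      let ?d = "\<lambda>j. of_real (1 - t) * b j + of_real t * c j"
      show "?d \<in> K"
        using lp_cball_convex[OF assms(5) C] that by (simp add: K_def)
      show "\<forall>i\<in>{1..n}. L i ?d = L i b + of_real t * (L i c - L i b)"
      proof
        fix i assume "i \<in> {1..n}"
        hence "(\<lambda>j. b j * l i ^ j) sums L i b" "(\<lambda>j. c j * l i ^ j) sums L i c"
          using that l unfolding K_def L_def
          by (auto intro!: summable_sums summable_lp_cball[OF assms(5) C])
        hence "(\<lambda>j. of_real (1 - t) * (b j * l i ^ j) + of_real t * (c j * l i ^ j))
            sums (of_real (1 - t) * L i b + of_real t * L i c)"
          by (intro sums_add sums_mult)
        moreover have "of_real (1 - t) * (b j * l i ^ j) + of_real t * (c j * l i ^ j) = ?d j * l i ^ j" for j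
          by (simp add: algebra_simps)
        ultimately have "L i ?d = of_real (1 - t) * L i b + of_real t * L i c"
          unfolding L_def by (simp add: sums_iff)
        thus "L i ?d = L i b + of_real t * (L i c - L i b)"
          by (simp add: algebra_simps)
      qed
    qed
    show "Re (\<Sum>i\<in>{1..n}. \<alpha> i * w i) \<le> M"
      if M: "\<And>b. b \<in> K \<Longrightarrow> Re (\<Sum>i\<in>{1..n}. \<alpha> i * L i b) \<le> M" for \<alpha> M
    proof -
      \<comment> \<open>The hypothesis bounds the left side by \<open>C\<close> times the norm of
        the moment sequence, and duality bounds that by any \<open>M\<close> dominating its pairings
        with \<open>K\<close>.\<close>
      let ?a = "\<lambda>j. \<Sum>i=1..n. \<alpha> i * l i ^ j"
      have "Re (\<Sum>i=1..n. \<alpha> i * w i) \<le> C * weighted_lp_norm p \<beta> ?a"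
        using complex_Re_le_cmod assms(7)[OF n] by (rule order_trans)
      also have "\<dots> \<le> M"
        using assms(5,6,4)
      proof (rule weighted_lp_norm_le_dual)
        show "?a \<in> weighted_lp p \<beta>"
          by (rule power_sums_in_weighted_lp[OF p]) (simp add: l)
        fix b assume b: "b \<in> lp_cball q (- \<beta>) C"
        have "(\<Sum>i\<in>{1..n}. \<alpha> i * L i b) = (\<Sum>j. ?a j * b j)"
          unfolding L_def using l by (intro sum_lp_cball_eval[OF assms(5) C b]) auto
        thus "Re (\<Sum>j. ?a j * b j) \<le> M"
          using M[of b] b by (simp add: K_def)
      qed
      finally show ?thesis .
    qed
  qed blast
  \<comment> \<open>Finite intersection property: solutions for finitely many nodes yield one for
    all nodes.\<close>
  have "K \<inter> (\<Inter>i\<in>{1..}. {b \<in> K. L i b = w i}) \<noteq> {}"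
  proof (rule compact_imp_fip_image[OF K])
    have "closed K"
      using K by (rule compact_imp_closed)
    thus "closed {b \<in> K. L i b = w i}" if "i \<in> {1..}" for i
      using continuous_closed_preimage[OF cont, of i "{w i}"] that
      by (simp add: vimage_def Collect_conj_eq)
    fix J :: "nat set" assume J: "finite J" "J \<subseteq> {1..}"
    \<comment> \<open>The inserted 1 makes \<open>Max\<close> meaningful for empty \<open>J\<close>
      and keeps the number of nodes at least 1.\<close>
    obtain b where b: "b \<in> K" "\<forall>i\<in>{1..Max (insert 1 J)}. L i b = w i"
      using solve[of "Max (insert 1 J)"] J by auto
    have "i \<in> {1..Max (insert 1 J)}" if "i \<in> J" for i
      using J that by auto
    hence "b \<in> K \<inter> (\<Inter>i\<in>J. {b \<in> K. L i b = w i})"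
      using b by blast
    thus "K \<inter> (\<Inter>i\<in>J. {b \<in> K. L i b = w i}) \<noteq> {}"
      by blast
  qed
  then obtain b where b: "b \<in> K" "\<And>i. 1 \<le> i \<Longrightarrow> L i b = w i"
    by auto
  define f where "f = restrict (\<lambda>z. \<Sum>j. b j * z ^ j) (ball 0 1)"
  have f: "f \<in> beurling_sobolev q (- \<beta>)" "taylor_coeff f = b"
    using lp_cball_power_series[OF assms(5) C b(1)[unfolded K_def]] by (simp_all add: f_def)
  have interp: "f (l i) = w i" if "1 \<le> i" for i
    using b(2)[OF that] assms(2)[OF that] by (simp add: f_def L_def)
  have "beurling_sobolev_norm q (- \<beta>) f \<le> C"
    using b(1) f(2) by (simp add: beurling_sobolev_norm_def K_def lp_cball_def)
  moreover have "g = f"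
    if "g \<in> beurling_sobolev q (- \<beta>)" "\<forall>i\<ge>1. g (l i) = w i" for g
  proof -
    obtain x where "x \<in> ball 0 1" "x islimpt l ` {1..}"
      using assms(3) by blast
    moreover have "l ` {1..} \<subseteq> ball 0 1"
      using assms(2) by auto
    ultimately show ?thesis
      using that(2) interp by (intro beurling_sobolev_eqI[OF that(1) f(1)]) auto
  qed
  moreover have "norm (\<Sum>i=1..n. \<alpha> i * f (z i)) \<le> C * weighted_lp_norm p \<beta> (\<lambda>j. \<Sum>i=1..n. \<alpha> i * z i ^ j)"
    if z: "\<forall>i\<ge>1. z i \<in> ball 0 1" for n :: nat and z \<alpha>
  proof -
    have z1: "norm (z i) < 1" if "i \<in> {1..n}" for i
      using z that by simp
    have "(\<Sum>i=1..n. \<alpha> i * f (z i)) = (\<Sum>i=1..n. \<alpha> i * (\<Sum>j. b j * z i ^ j))"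
      using z by (intro sum.cong refl) (simp add: f_def)
    \<comment> \<open>The points \<open>z i\<close> enter only through their moment sequence, which
      is paired with the coefficients of \<open>f\<close>.\<close>
    also have "\<dots> = (\<Sum>j. (\<Sum>i=1..n. \<alpha> i * z i ^ j) * b j)"
      using b(1) z1 by (intro sum_lp_cball_eval[OF assms(5) C]) (auto simp: K_def)
    also have "norm \<dots> \<le> C * weighted_lp_norm p \<beta> (\<lambda>j. \<Sum>i=1..n. \<alpha> i * z i ^ j)"
      using b(1) unfolding K_def
      by (intro norm_pairing_le[OF assms(5,6,4)] power_sums_in_weighted_lp[OF p] z1)
    finally show ?thesis .
  qed
  ultimately show ?thesis
    using f(1) interp by blast
qed

end
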